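(* Let $m,n\ge1$, let $\mathcal{G}=([m],E)$ be an undirected graph, let $G=\{g\in \mathrm{GL}_m(\mathbb{R}) \mid g\cdot \mathcal{S}^+_{\mathcal{G}}\subseteq \mathcal{S}^+_{\mathcal{G}}\}$, and assume that $n\ge\max_{i\in[m]}|{\downarrow} i|$. Then for any $G$-equivariant estimator $T:\mathbb{R}^{m\times n}\to\mathcal{S}^+_{\mathcal{G}}$, the finite sample breakdown point of $T$ at a generic sample $\mathbf{x}\in\mathbb{R}^{m\times n}$ is at most $$\frac{1}{n}\left\lceil\frac{n-\max_{i\in[m]}|{\downarrow} i|+1}{2}\right\rceil.$$
   Context: Graphs are finite and simple, $[m]=\{1,\dots,m\}$, and $E$ is a set of two-element subsets of $[m]$. $\mathcal{S}_{\mathcal{G}}$ is the linear space of real symmetric $m\times m$ matrices whose $(i,j)$ entry is zero whenever $i\ne j$ and $\{i,j\}\notin E$; $\mathcal{S}^+_{\mathcal{G}}$ is the set of positive definite matrices in $\mathcal{S}_{\mathcal{G}}$. $\mathrm{GL}_m(\mathbb{R})$ acts on real symmetric $m\times m$ matrices by $g\cdot K=g^{-T}Kg^{-1}$ and on $\mathbb{R}^{m\times n}$ by left multiplication; the columns of $\mathbf{x}\in\mathbb{R}^{m\times n}$ are the $n$ sample points. Writing $N(i)=\{j\in[m]: \{i,j\}\in E\}$, the pre-order $\preccurlyeq$ on $[m]$ is defined by $i\preccurlyeq j$ iff $N(j)\cup\{j\}\subseteq N(i)\cup\{i\}$, and ${\downarrow} i=\{j\in[m]: j\preccurlyeq i\}$.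 A $G$-equivariant estimator (of the concentration matrix) is a map $T:\mathbb{R}^{m\times n}\to\mathcal{S}^+_{\mathcal{G}}$, possibly defined only outside some (typically $G$-stable) measure-zero set, that satisfies $T(g\mathbf{x})=g\cdot T(\mathbf{x})$ for all $g\in G$ there. On positive definite matrices consider the pseudo-metric $D(K_1,K_2)=|\log\det(K_1K_2^{-1})|$. The finite sample breakdown point of $T$ at $\mathbf{x}$ is $d/n$, where $d$ is the minimal number of sample points (columns) of $\mathbf{x}$ that need to be altered to force arbitrarily large changes in the value of the estimator, i.e. the smallest $d$ such that $D(T(\mathbf{x}),T(\mathbf{y}))$ is unbounded as $\mathbf{y}$ ranges over the samples (in the domain of $T$) that differ from $\mathbf{x}$ in at most $d$ columns. A property holds for generic $\mathbf{x}$ if it holds for all $\mathbf{x}$ outside the zero set of some nonzero polynomial in the entries of $\mathbf{x}$.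
   Formalization: For an estimator undefined on an arbitrary measure-zero set the claim for polynomially generic samples is false; it is proved when the estimator is defined at generic samples (off a polynomial's zero set), and for almost every sample otherwise. *)

theory Defs
  imports "HOL-Analysis.Analysis"
begin

text \<open>
  The vertex set \<open>[m]\<close> is the finite type \<open>'m\<close>, the sample points are indexed by the finite
  type \<open>'n\<close>, and a sample is an \<open>m \<times> n\<close> matrix \<open>x :: real^'n^'m\<close>, whose sample points are
  \<open>column j x\<close>.
\<close>

section \<open>Graphs and the vertex pre-order\<close>

definition graph_edges :: "'m set set \<Rightarrow> bool" where
  "graph_edges E \<longleftrightarrow> (\<forall>e\<in>E. card e = 2)"

definition nbhd :: "'m set set \<Rightarrow> 'm \<Rightarrow> 'm set" where
  "nbhd E i = {j. {i, j} \<in> E}"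

definition vertex_le :: "'m set set \<Rightarrow> 'm \<Rightarrow> 'm \<Rightarrow> bool" where
  "vertex_le E i j \<longleftrightarrow> nbhd E j \<union> {j} \<subseteq> nbhd E i \<union> {i}"

definition down_set :: "'m set set \<Rightarrow> 'm \<Rightarrow> 'm set" where
  "down_set E i = {j. vertex_le E j i}"


section \<open>Concentration matrices and the group\<close>

definition sym_matrices :: "'m::finite set set \<Rightarrow> (real^'m^'m) set" where
  "sym_matrices E =
     {K. transpose K = K \<and> (\<forall>i j. i \<noteq> j \<and> {i, j} \<notin> E \<longrightarrow> K $ i $ j = 0)}"

definition pos_def_matrices :: "'m::finite set set \<Rightarrow> (real^'m^'m) set" where
  "pos_def_matrices E = {K \<in> sym_matrices E. \<forall>v. v \<noteq> 0 \<longrightarrow> v \<bullet> (K *v v) > 0}"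

definition GL_act :: "real^'m^'m \<Rightarrow> real^'m^'m \<Rightarrow> real^'m^'m::finite" where
  "GL_act g K = transpose (matrix_inv g) ** K ** matrix_inv g"

definition graph_group :: "'m::finite set set \<Rightarrow> (real^'m^'m) set" where
  "graph_group E = {g. invertible g \<and> GL_act g ` pos_def_matrices E \<subseteq> pos_def_matrices E}"


section \<open>Estimators and breakdown points\<close>

text \<open>
  The set \<open>U\<close> is the domain of the estimator \<open>T\<close>; the values of \<open>T\<close> outside \<open>U\<close> are irrelevant.
  It is not required to be stable under \<open>G\<close>, so equivariance is demanded whenever
  both sides are defined.
\<close>

definition equivariant_estimator ::
    "'m::finite set set \<Rightarrow> (real^'m^'m) set \<Rightarrow> (real^'n::finite^'m) set
      \<Rightarrow> (real^'n^'m \<Rightarrow> real^'m^'m) \<Rightarrow> bool" where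
  "equivariant_estimator E G U T \<longleftrightarrow>
     negligible (- U) \<and>
     (\<forall>x\<in>U. T x \<in> pos_def_matrices E) \<and>
     (\<forall>g\<in>G. \<forall>x. x \<in> U \<and> g ** x \<in> U \<longrightarrow> T (g ** x) = GL_act g (T x))"

definition logdet_dist :: "real^'m^'m \<Rightarrow> real^'m^'m::finite \<Rightarrow> real" where
  "logdet_dist K1 K2 = \<bar>ln (det (K1 ** matrix_inv K2))\<bar>"

definition altered_samples ::
    "(real^'n::finite^'m::finite) set \<Rightarrow> real^'n^'m \<Rightarrow> nat \<Rightarrow> (real^'n^'m) set" where
  "altered_samples U x d = {y \<in> U. card {j. column j x \<noteq> column j y} \<le> d}"

text \<open>
  The infimum is taken in \<^typ>\<open>ereal\<close> so that the breakdown point is \<open>\<infinity>\<close> if no number of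
  alterations makes the estimator break down; otherwise it is a minimum.
\<close>

definition breakdown_point ::
    "(real^'n::finite^'m::finite) set \<Rightarrow> (real^'n^'m \<Rightarrow> real^'m^'m) \<Rightarrow> real^'n^'m \<Rightarrow> ereal" where
  "breakdown_point U T x =
     (INF d \<in> {d. \<not> bdd_above ((\<lambda>y. logdet_dist (T x) (T y)) ` altered_samples U x d)}.
        ereal (real d / real CARD('n)))"

text \<open>
  On \<open>real^'n^'m\<close> the \<^const>\<open>real_polynomial_function\<close>s are exactly the functions given by
  polynomials in the matrix entries. Since the reals are infinite, a polynomial is nonzero iff its
  function is not identically zero.
\<close>

definition generically :: "(real^'n::finite^'m::finite \<Rightarrow> bool) \<Rightarrow> bool" where
  "generically P \<longleftrightarrow>
     (\<exists>p. real_polynomial_function p \<and> (\<exists>x. p x \<noteq> 0) \<and> (\<forall>x. p x \<noteq> 0 \<longrightarrow> P x))"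

end

theory Submission
  imports Defs
begin

text \<open>
  Fix a vertex \<open>i\<close> for which \<open>q = |\<down>i|\<close> is maximal. The group of the graph contains the shears that
  replace row \<open>i\<close> of a sample by a linear combination of the rows in \<open>\<down>i\<close>
  (\<open>shear_in_graph_group\<close>). For a sample \<open>x\<close> and \<open>q - 1\<close> chosen columns \<open>J\<close>, generically there is exactly
  one combination \<open>a\<close> of the rows in \<open>\<down>i - {i}\<close> that agrees with row \<open>i\<close> on \<open>J\<close>. The shear \<open>g\<^sub>s\<close>
  that multiplies the difference between row \<open>i\<close> and this combination by \<open>s\<close> therefore has
  determinant \<open>s\<close> and fixes the columns of \<open>x\<close> in \<open>J\<close>.

  Split the remaining \<open>n - q + 1\<close> columns into two parts \<open>A\<close> and \<open>B\<close> of size at most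
  \<open>d = \<lceil>(n - q + 1) / 2\<rceil>\<close>. Let \<open>y\<close> arise from \<open>x\<close> by applying \<open>g\<^sub>s\<close> to the columns in \<open>B\<close> only, and
  \<open>z\<close> by applying the inverse of \<open>g\<^sub>s\<close> to the columns in \<open>A\<close> only. Both differ from \<open>x\<close> in at most
  \<open>d\<close> columns, and \<open>y = g\<^sub>s z\<close> (\<open>shear_stretch\<close>). Equivariance gives
  \<open>ln det T(y) = ln det T(z) - 2 ln s\<close>, so as \<open>s\<close> grows \<open>T(y)\<close> and \<open>T(z)\<close> cannot both stay at
  bounded distance from \<open>T(x)\<close> (\<open>breakdown_point_le_if_large_shears\<close>).

  What remains is that \<open>y\<close> and \<open>z\<close> must lie in the domain \<open>U\<close> of \<open>T\<close> for arbitrarily large \<open>s\<close>.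
  If \<open>U\<close> contains the complement of the zero set of a polynomial \<open>p\<close> with \<open>p(x) \<noteq> 0\<close>, then this
  fails for only finitely many \<open>s\<close>, because \<open>y\<close> is affine in \<open>s\<close>, \<open>z\<close> is affine in \<open>1/s\<close>, and both
  equal \<open>x\<close> at \<open>s = 1\<close> (\<open>stretches_in_domain_generic\<close>). If \<open>U\<close> is merely of full measure, then for each fixed
  \<open>s\<close> the maps \<open>x \<mapsto> y\<close> and \<open>x \<mapsto> z\<close> have differentiable inverses of the same kind, so that they pull
  null sets back to null sets; almost every \<open>x\<close> is thus good for all natural numbers \<open>s \<ge> 1\<close> at once
  (\<open>stretches_in_domain_AE\<close>).
\<close>

section \<open>Zero sets of real polynomials\<close>

lemma finite_zeros_real_polynomial:
  fixes p :: "real \<Rightarrow> real"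
  assumes "real_polynomial_function p" "p t0 \<noteq> 0"
  shows "finite {t. p t = 0}"
proof -
  obtain a n where p: "p = (\<lambda>x. \<Sum>i\<le>n. a i * x^i)"
    using assms(1) real_polynomial_function_iff_sum by blast
  then have "\<exists>i\<le>n. a i \<noteq> 0"
    using assms(2) by (metis (no_types, lifting) atMost_iff mult_zero_left sum.neutral)
  then show ?thesis
    using polyfun_finite_roots[of a n] p by simp
qed

lemma finite_zeros_on_line:
  fixes p :: "'a::real_normed_vector \<Rightarrow> real"
  assumes "real_polynomial_function p" "p (a + t0 *\<^sub>R b) \<noteq> 0"
  shows "finite {t. p (a + t *\<^sub>R b) = 0}"
proof -
  have "polynomial_function (\<lambda>t. a + t *\<^sub>R b)"
    by (intro polynomial_function_add polynomial_function_const polynomial_function_bounded_linear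
        bounded_linear_scaleR_left)
  then have "real_polynomial_function (\<lambda>t. p (a + t *\<^sub>R b))"
    using real_polynomial_function_compose[OF _ assms(1)] by (simp add: o_def)
  with assms(2) show ?thesis
    by (rule finite_zeros_real_polynomial[rotated])
qed

text \<open>
  Move \<open>x0\<close> to the origin and rescale a bounded piece \<open>S\<close> of the zero set by infinitely many distinct
  factors between \<open>1/2\<close> and \<open>1\<close>. A point lies in only finitely many of the rescaled copies, since
  the polynomial has finitely many zeros on the line through that point and the origin, where it
  does not vanish. By dominated convergence the measures of the copies tend to \<open>0\<close>; but they are
  bounded below by a fixed positive multiple of the measure of \<open>S\<close>.
\<close>
lemma negligible_zeros_real_polynomial:
  fixes p :: "'a::euclidean_space \<Rightarrow> real"
  assumes p: "real_polynomial_function p" and x0: "p x0 \<noteq> 0"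
  shows "negligible {x. p x = 0}"
proof -
  define q where "q y = p (x0 + y)" for y
  have "polynomial_function (\<lambda>y. x0 + y)"
    by (intro polynomial_function_add polynomial_function_const polynomial_function_id)
  then have q: "real_polynomial_function q"
    using real_polynomial_function_compose[OF _ p] unfolding o_def q_def[abs_def] by blast
  have bounded_part: "negligible ({y. q y = 0} \<inter> cball 0 R)" if "R \<ge> 0" for R
  proof -
    define S where "S = {y. q y = 0} \<inter> cball 0 R"
    have "continuous_on UNIV q"
      using q by (simp add: continuous_on_polymonial_function real_polynomial_function_eq)
    then have "closed {y. q y = 0}"
      by (intro closed_Collect_eq) auto
    then have S: "compact S"
      unfolding S_def by (intro closed_Int_compact) auto
    then have Sm: "S \<in> lmeasurable"
      by (rule lmeasurable_compact)
    define u where "u k = 1 + 1 / (1 + real k)" for k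
    have u: "1 \<le> u k" "u k \<le> 2" for k
      by (auto simp: u_def field_simps)
    have "inj u"
      by (rule injI) (simp add: u_def field_simps)
    \<comment> \<open>The trivial translation gives the image the shape required by \<open>measure_lebesgue_affine\<close>.\<close>
    define D where "D k = (\<lambda>y. (1 / u k) *\<^sub>R y + 0) ` S" for k
    have D_iff: "y \<in> D k \<longleftrightarrow> u k *\<^sub>R y \<in> S" for y k
      unfolding D_def using u(1)[of k] by (auto simp: image_iff intro!: bexI[of _ "u k *\<^sub>R y"])
    have "compact (D k)" for k
      unfolding D_def using S by (intro compact_continuous_image continuous_intros) auto
    then have Dm: "D k \<in> lmeasurable" for k
      by (rule lmeasurable_compact)
    have "(\<lambda>k. integral\<^sup>L lebesgue (indicat_real (D k))) \<longlonglongrightarrow> integral\<^sup>L lebesgue (\<lambda>y::'a. 0)"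
    proof (rule integral_dominated_convergence[where w="indicat_real (cball 0 R)"])
      show "indicat_real (D k) \<in> borel_measurable lebesgue" for k
        using Dm by (intro borel_measurable_indicator) auto
      show "integrable lebesgue (indicat_real (cball (0::'a) R))"
        using lmeasurable_cball[of "0::'a" R] unfolding fmeasurable_def
        by (intro integrable_real_indicator) auto
      show "AE y in lebesgue. (\<lambda>k. indicat_real (D k) y) \<longlonglongrightarrow> 0"
      proof (rule AE_I2)
        fix y :: 'a
        have "finite {t. q (0 + t *\<^sub>R y) = 0}"
          using x0 by (intro finite_zeros_on_line[OF q, of _ 0]) (simp add: q_def)
        then have "finite (u -` {t. q (t *\<^sub>R y) = 0})"
          using \<open>inj u\<close> by (intro finite_vimageI) auto
        then have "finite {k. y \<in> D k}"
          by (rule finite_subset[rotated]) (auto simp: D_iff S_def)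
        then have "eventually (\<lambda>k. y \<notin> D k) sequentially"
          by (simp add: MOST_iff_cofinite flip: cofinite_eq_sequentially)
        then show "(\<lambda>k. indicat_real (D k) y) \<longlonglongrightarrow> 0"
          by (intro tendsto_eventually) (auto elim: eventually_mono)
      qed
      show "AE y in lebesgue. norm (indicat_real (D k) y) \<le> indicat_real (cball 0 R) y" for k
      proof (rule AE_I2)
        fix y :: 'a
        have "norm y \<le> u k * norm y"
          using u(1)[of k] by (simp add: mult_le_cancel_right1)
        then have "y \<in> D k \<Longrightarrow> y \<in> cball 0 R"
          using u(1)[of k] by (auto simp: D_iff S_def)
        then show "norm (indicat_real (D k) y) \<le> indicat_real (cball 0 R) y"
          by (auto simp: indicator_def)
      qed
    qed auto
    then have lim: "(\<lambda>k. measure lebesgue (D k)) \<longlonglongrightarrow> 0"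
      using Dm by simp
    have "measure lebesgue S / 2 ^ DIM('a) \<le> measure lebesgue (D k)" for k
    proof -
      have "(1 / 2) ^ DIM('a) \<le> (1 / u k) ^ DIM('a)"
        using u[of k] by (intro power_mono) (auto simp: field_simps)
      then have "(1 / 2) ^ DIM('a) * measure lebesgue S \<le> (1 / u k) ^ DIM('a) * measure lebesgue S"
        by (rule mult_right_mono) simp
      then show ?thesis
        unfolding D_def measure_lebesgue_affine using u(1)[of k] by (simp add: power_one_over)
    qed
    then have "measure lebesgue S / 2 ^ DIM('a) \<le> 0"
      using lim by (intro tendsto_lowerbound[OF lim]) auto
    then have "measure lebesgue S = 0"
      by (simp add: divide_le_0_iff)
        (metis measure_nonneg not_le order_antisym zero_less_numeral zero_less_power)
    then show ?thesis
      using Sm negligible_iff_measure0 S_def by blast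
  qed
  have "{y. q y = 0} = (\<Union>k::nat. {y. q y = 0} \<inter> cball 0 (real k))"
    by (auto simp: real_arch_simple)
  moreover have "negligible (\<Union>k::nat. {y. q y = 0} \<inter> cball 0 (real k))"
    using bounded_part by (intro negligible_countable_Union) auto
  ultimately have "negligible {y. q y = 0}"
    by simp
  then have "negligible ((+) x0 ` {y. q y = 0})"
    by (rule negligible_translation)
  moreover have "{x. p x = 0} = (+) x0 ` {y. q y = 0}"
    by (force simp: q_def image_iff intro: exI[of _ "x - x0" for x])
  ultimately show ?thesis
    by simp
qed

lemma real_polynomial_function_entry: "real_polynomial_function (\<lambda>x::real^'n^'m. x $ i $ j)"
  by (intro real_polynomial_function.intros(1) bounded_linear_compose[OF bounded_linear_vec_nth]
      bounded_linear_vec_nth)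

lemma real_polynomial_function_det:
  fixes A :: "'a::real_normed_vector \<Rightarrow> real^'m^'m"
  assumes "\<And>i j. real_polynomial_function (\<lambda>x. A x $ i $ j)"
  shows "real_polynomial_function (\<lambda>x. det (A x))"
  unfolding det_def
  by (intro real_polynomial_function_sum real_polynomial_function.intros(4)
      real_polynomial_function.intros(2) real_polynomial_function_prod assms finite_permutations) auto

section \<open>Determinants of concentration matrices\<close>

text \<open>
  The segment from the identity to \<open>K\<close> consists of positive definite, hence invertible, matrices,
  so the determinant cannot change sign on it.
\<close>
lemma det_pos_of_positive_definite:
  fixes K :: "real^'m^'m"
  assumes "\<And>v. v \<noteq> 0 \<Longrightarrow> v \<bullet> (K *v v) > 0"
  shows "det K > 0"
proof (rule ccontr)
  define P where "P t = t *\<^sub>R K + (1 - t) *\<^sub>R (mat 1 :: real^'m^'m)" for t :: real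
  have nz: "det (P t) \<noteq> 0" if "0 \<le> t" "t \<le> 1" for t
  proof
    assume "det (P t) = 0"
    then have "\<not> invertible (P t)"
      by (simp add: invertible_det_nz)
    then obtain v where v: "P t *v v = 0" "v \<noteq> 0"
      unfolding invertible_left_inverse matrix_left_invertible_ker by blast
    have "v \<bullet> (P t *v v) = t * (v \<bullet> (K *v v)) + (1 - t) * (v \<bullet> v)"
      by (simp add: P_def matrix_vector_mult_add_rdistrib inner_right_distrib
          flip: scaleR_matrix_vector_assoc)
    also have "\<dots> > 0"
      using assms[OF v(2)] v(2) that
      by (cases "t = 0") (auto intro!: add_pos_nonneg mult_pos_pos mult_nonneg_nonneg)
    finally show False
      using v(1) by simp
  qed
  assume "\<not> det K > 0"
  moreover have "continuous_on {0..1} (\<lambda>t. det (P t))"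
    unfolding det_def P_def by (intro continuous_intros)
  moreover have "P 0 = mat 1" "P 1 = K"
    by (simp_all add: P_def)
  ultimately obtain t where "0 \<le> t" "t \<le> 1" "det (P t) = 0"
    using IVT2'[of "\<lambda>t. det (P t)" 1 0 0] by auto
  with nz show False
    by blast
qed

lemma det_matrix_inv:
  fixes g :: "real^'m^'m"
  assumes "invertible g"
  shows "det (matrix_inv g) = 1 / det g"
proof -
  have "g ** matrix_inv g = mat 1"
    using assms someI_ex[of "\<lambda>h. g ** h = mat 1 \<and> h ** g = mat 1"]
    unfolding invertible_def matrix_inv_def by blast
  then have "det g * det (matrix_inv g) = 1"
    by (metis det_I det_mul)
  then show ?thesis
    by (metis mult_zero_left nonzero_mult_div_cancel_left zero_neq_one)
qed

lemma logdet_dist_eq: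
  assumes "det K1 > 0" "det K2 > 0"
  shows "logdet_dist K1 K2 = \<bar>ln (det K1) - ln (det K2)\<bar>"
proof -
  have "invertible K2"
    using assms by (simp add: invertible_det_nz)
  then show ?thesis
    using assms by (simp add: logdet_dist_def det_mul det_matrix_inv ln_div)
qed

lemma det_GL_act:
  assumes "invertible g"
  shows "det (GL_act g K) = det K / (det g)\<^sup>2"
  by (simp add: GL_act_def det_mul det_transpose det_matrix_inv[OF assms] power2_eq_square)

section \<open>Shears in the group of the graph\<close>

text \<open>
  The matrix maps row \<open>i\<close> of a sample, \<open>x\<^sub>i\<close>, to \<open>c + s (x\<^sub>i - c)\<close> with \<open>c = \<Sum>\<^sub>k a\<^sub>k x\<^sub>k\<close>, and fixes the
  other rows. In this parametrization, and with \<open>a\<^sub>i = 0\<close>, the shears for fixed \<open>a\<close> and \<open>s \<noteq> 0\<close> form a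
  one-parameter group in which \<open>s\<close> is the determinant.
\<close>
definition shear :: "'m::finite \<Rightarrow> real^'m \<Rightarrow> real \<Rightarrow> real^'m^'m" where
  "shear i a s = mat 1 + (s - 1) *\<^sub>R (\<chi> r c. if r = i then (if c = i then 1 else 0) - a $ c else 0)"

lemma shear_mult_entry:
  "(shear i a s ** x) $ r $ c =
     x $ r $ c + (if r = i then (s - 1) * (x $ i $ c - (\<Sum>k\<in>UNIV. a $ k * x $ k $ c)) else 0)"
proof (cases "r = i")
  case True
  have "(shear i a s ** x) $ i $ c =
      (\<Sum>k\<in>UNIV. (if i = k then 1 else 0) * x $ k $ c
        + (s - 1) * ((if k = i then 1 else 0) * x $ k $ c - a $ k * x $ k $ c))"
    unfolding matrix_matrix_mult_def shear_def mat_def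
    by (auto intro!: sum.cong simp: algebra_simps)
  also have "\<dots> = x $ i $ c + (s - 1) * (x $ i $ c - (\<Sum>k\<in>UNIV. a $ k * x $ k $ c))"
    by (simp add: sum.distrib sum_subtractf if_distrib[of "\<lambda>z. z * _"] 
        flip: sum_distrib_left cong: if_cong)
  finally show ?thesis
    using True by simp
next
  case False
  then show ?thesis
    unfolding matrix_matrix_mult_def shear_def mat_def
    by (simp add: if_distrib[of "\<lambda>z. z * _"] cong: if_cong)
qed

lemma shear_mult_shear:
  assumes "a $ i = 0"
  shows "shear i a s ** shear i a t = shear i a (s * t)"
proof -
  have *: "(\<Sum>k\<in>UNIV. a $ k * shear i a t $ k $ c) = a $ c" for c
  proof -
    have "(\<Sum>k\<in>UNIV. a $ k * shear i a t $ k $ c) = (\<Sum>k\<in>UNIV. if k = c then a $ k else 0)"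
      using assms by (intro sum.cong) (auto simp: shear_def mat_def)
    then show ?thesis
      by simp
  qed
  show ?thesis
    unfolding vec_eq_iff shear_mult_entry *
    by (auto simp: shear_def mat_def algebra_simps)
qed

lemma shear_1 [simp]: "shear i a 1 = mat 1"
  by (simp add: shear_def)

lemma det_shear:
  assumes "a $ i = 0"
  shows "det (shear i a s) = s"
proof -
  define v where "v = (\<chi> c. if c = i then s else (1 - s) * a $ c)"
  have "shear i a s = (\<chi> r. if r = i then (\<Sum>k\<in>UNIV. v $ k *s row k (mat 1)) else row r (mat 1))"
  proof -
    have "(\<Sum>k\<in>UNIV. v $ k * (if k = c then 1 else 0)) = v $ c" for c
      by (simp add: if_distrib cong: if_cong)
    then show ?thesis
      using assms unfolding vec_eq_iff
      by (auto simp: shear_def mat_def row_def v_def algebra_simps)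
  qed
  then have "det (shear i a s) = v $ i * det (mat 1 :: real^'a^'a)"
    using cramer_lemma_transpose[of i v "mat 1"] by simp
  then show ?thesis
    by (simp add: v_def)
qed

lemma matrix_inv_shear:
  assumes "a $ i = 0" "s \<noteq> 0"
  shows "invertible (shear i a s)" "matrix_inv (shear i a s) = shear i a (1 / s)"
proof -
  have 1: "shear i a s ** shear i a (1 / s) = mat 1" "shear i a (1 / s) ** shear i a s = mat 1"
    using assms by (simp_all add: shear_mult_shear)
  then show inv: "invertible (shear i a s)"
    unfolding invertible_def by blast
  have "matrix_inv (shear i a s) ** shear i a s = mat 1"
    using inv someI_ex[of "\<lambda>h. shear i a s ** h = mat 1 \<and> h ** shear i a s = mat 1"]
    unfolding invertible_def matrix_inv_def by blast
  then show "matrix_inv (shear i a s) = shear i a (1 / s)"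
    by (metis 1(1) matrix_mul_assoc matrix_mul_lid matrix_mul_rid)
qed

text \<open>
  If an entry of \<open>K\<close> links \<open>k\<close> and \<open>l\<close>, then \<open>l\<close> lies in the closed neighbourhood of \<open>k\<close>; replacing
  \<open>k\<close> by some \<open>p \<preceq> k\<close> and then \<open>l\<close> by some \<open>r \<preceq> l\<close> only enlarges the neighbourhoods. So every
  nonzero summand of the \<open>(p, r)\<close> entry of the product forces \<open>p = r\<close> or \<open>{p, r} \<in> E\<close>.
\<close>
lemma congruence_preserves_sparsity:
  assumes K: "K \<in> sym_matrices E"
    and h: "\<And>k p. h $ k $ p \<noteq> 0 \<Longrightarrow> vertex_le E p k"
  shows "transpose h ** K ** h \<in> sym_matrices E"
proof -
  have nbhd: "l \<in> nbhd E k \<union> {k} \<longleftrightarrow> k \<in> nbhd E l \<union> {l}" for k l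
    by (auto simp: nbhd_def insert_commute)
  have "(transpose h ** K ** h) $ p $ r = 0" if pr: "p \<noteq> r" "{p, r} \<notin> E" for p r
  proof -
    have "h $ k $ p * K $ k $ l * h $ l $ r = 0" for k l
    proof (rule ccontr)
      assume nz: "h $ k $ p * K $ k $ l * h $ l $ r \<noteq> 0"
      then have "K $ k $ l \<noteq> 0"
        by auto
      then have "l \<in> nbhd E k \<union> {k}"
        using K by (simp add: sym_matrices_def nbhd_def) metis
      then have "l \<in> nbhd E p \<union> {p}"
        using nz h[of k p] by (auto simp: vertex_le_def)
      then have "p \<in> nbhd E l \<union> {l}"
        using nbhd by blast
      then have "p \<in> nbhd E r \<union> {r}"
        using nz h[of l r] by (auto simp: vertex_le_def)
      then show False
        using pr by (auto simp: nbhd_def insert_commute)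
    qed
    then show ?thesis
      unfolding matrix_matrix_mult_def transpose_def
      by (auto simp: sum_distrib_right intro!: sum.neutral)
  qed
  moreover have "transpose (transpose h ** K ** h) = transpose h ** K ** h"
    using K by (simp add: sym_matrices_def matrix_transpose_mul matrix_mul_assoc)
  ultimately show ?thesis
    by (simp add: sym_matrices_def)
qed

lemma shear_in_graph_group:
  assumes a: "a $ i = 0" "\<And>k. a $ k \<noteq> 0 \<Longrightarrow> k \<in> down_set E i" and "s \<noteq> 0"
  shows "shear i a s \<in> graph_group E"
proof -
  define h where "h = shear i a (1 / s)"
  have "GL_act (shear i a s) K \<in> pos_def_matrices E" if K: "K \<in> pos_def_matrices E" for K
  proof -
    have eq: "GL_act (shear i a s) K = transpose h ** K ** h"
      by (simp add: GL_act_def matrix_inv_shear a \<open>s \<noteq> 0\<close> h_def)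
    have "transpose h ** K ** h \<in> sym_matrices E"
    proof (rule congruence_preserves_sparsity)
      show "K \<in> sym_matrices E"
        using K by (simp add: pos_def_matrices_def)
      show "vertex_le E p k" if "h $ k $ p \<noteq> 0" for k p
      proof (cases "p = k")
        case True
        then show ?thesis by (simp add: vertex_le_def)
      next
        case False
        with that have "k = i" "a $ p \<noteq> 0"
          by (auto simp: h_def shear_def mat_def split: if_splits)
        then show ?thesis
          using a(2)[of p] by (simp add: down_set_def)
      qed
    qed
    moreover have "v \<bullet> ((transpose h ** K ** h) *v v) > 0" if "v \<noteq> 0" for v
    proof -
      have "shear i a s *v (h *v v) = v"
        using a(1) \<open>s \<noteq> 0\<close> by (simp add: matrix_vector_mul_assoc h_def shear_mult_shear)
      then have "h *v v \<noteq> 0"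
        using that by auto
      then have "(h *v v) \<bullet> (K *v (h *v v)) > 0"
        using K by (simp add: pos_def_matrices_def)
      moreover have "v \<bullet> ((transpose h ** K ** h) *v v) = (h *v v) \<bullet> (K *v (h *v v))"
        by (metis dot_lmul_matrix matrix_vector_mul_assoc vector_transpose_matrix)
      ultimately show ?thesis
        by simp
    qed
    ultimately show ?thesis
      by (simp add: eq pos_def_matrices_def)
  qed
  then show ?thesis
    using matrix_inv_shear(1)[OF a(1) \<open>s \<noteq> 0\<close>] by (auto simp: graph_group_def)
qed

text \<open>
  By equivariance \<open>T(z)\<close> and \<open>T(g z)\<close> are at distance \<open>2 |ln |det g||\<close>, so by the triangle inequality
  one of them is at distance at least \<open>ln |det g|\<close> from \<open>T(x)\<close>.
\<close>
lemma breakdown_point_le_if_large_shears: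
  fixes U :: "(real^'n::finite^'m::finite) set"
  assumes T: "equivariant_estimator E (graph_group E) U T" and x: "x \<in> U"
    and pairs: "\<And>C. \<exists>g\<in>graph_group E. \<exists>z\<in>altered_samples U x d.
      g ** z \<in> altered_samples U x d \<and> \<bar>det g\<bar> > C"
  shows "breakdown_point U T x \<le> ereal (real d / real CARD('n))"
proof -
  have "\<not> bdd_above ((\<lambda>y. logdet_dist (T x) (T y)) ` altered_samples U x d)"
  proof
    assume "bdd_above ((\<lambda>y. logdet_dist (T x) (T y)) ` altered_samples U x d)"
    then obtain C where C: "\<And>y. y \<in> altered_samples U x d \<Longrightarrow> logdet_dist (T x) (T y) \<le> C"
      by (auto simp: bdd_above_def)
    obtain g z where g: "g \<in> graph_group E" "\<bar>det g\<bar> > exp C"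
      and z: "z \<in> altered_samples U x d" "g ** z \<in> altered_samples U x d"
      using pairs[of "exp C"] by blast
    have pos: "det (T y) > 0" if "y \<in> U" for y
    proof -
      have "T y \<in> pos_def_matrices E"
        using T that by (simp add: equivariant_estimator_def)
      then show ?thesis
        by (intro det_pos_of_positive_definite) (simp add: pos_def_matrices_def)
    qed
    have U: "z \<in> U" "g ** z \<in> U"
      using z by (auto simp: altered_samples_def)
    then have "T (g ** z) = GL_act g (T z)"
      using T g by (simp add: equivariant_estimator_def)
    then have "det (T (g ** z)) = det (T z) / \<bar>det g\<bar>\<^sup>2"
      using g by (simp add: graph_group_def det_GL_act)
    moreover have "\<bar>det g\<bar> > 0"
      using g(2) exp_gt_zero[of C] by linarith
    ultimately have "ln (det (T (g ** z))) = ln (det (T z)) - 2 * ln \<bar>det g\<bar>"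
      using pos[OF U(1)] by (simp only: ln_div ln_realpow zero_less_power) simp
    moreover have "ln \<bar>det g\<bar> > C"
      using g(2) \<open>\<bar>det g\<bar> > 0\<close> by (metis exp_less_cancel_iff exp_ln)
    moreover have "\<bar>ln (det (T x)) - ln (det (T y))\<bar> \<le> C"
      if "y \<in> altered_samples U x d" "y \<in> U" for y
      using C[OF that(1)] logdet_dist_eq pos x that(2) by metis
    ultimately show False
      using z U by (smt (verit))
  qed
  then show ?thesis
    unfolding breakdown_point_def by (intro INF_lower) simp
qed

section \<open>Interpolating one row by others\<close>

locale row_interpolation =
  fixes i :: "'m::finite" and L :: "'m set" and \<sigma> :: "'m \<Rightarrow> 'n::finite"
  assumes i_notin_L: "i \<notin> L" and inj_\<sigma>: "inj_on \<sigma> L"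
begin

text \<open>
  The columns \<open>\<sigma> ` L\<close> are the nodes at which row \<open>i\<close> of a sample is interpolated by a combination of
  the rows in \<open>L\<close>. The square linear system for the coefficients is padded by the identity to a
  matrix indexed by all vertices, which makes the coefficients outside \<open>L\<close> vanish.
\<close>

definition system :: "real^'n^'m \<Rightarrow> real^'m^'m" where
  "system x = (\<chi> l k. if l \<in> L \<and> k \<in> L then x $ k $ \<sigma> l else if l = k then 1 else 0)"

definition target :: "real^'n^'m \<Rightarrow> real^'m" where
  "target x = (\<chi> l. if l \<in> L then x $ i $ \<sigma> l else 0)"

text \<open>
  The coefficients of the interpolating combination by Cramer's rule, which exhibits them as
  rational functions of the sample.
\<close>
definition weights :: "real^'n^'m \<Rightarrow> real^'m" where
  "weights x = (\<chi> k. det (\<chi> l c. if c = k then target x $ l else system x $ l $ c) / det (system x))"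

definition residual :: "real^'n^'m \<Rightarrow> 'n \<Rightarrow> real" where
  "residual x c = x $ i $ c - (\<Sum>k\<in>UNIV. weights x $ k * x $ k $ c)"

text \<open>
  On the columns in \<open>B\<close> this is multiplication by \<open>shear i (weights x) s\<close>. It is not a linear map,
  as the weights depend on the sample.
\<close>
definition stretch :: "'n set \<Rightarrow> real \<Rightarrow> real^'n^'m \<Rightarrow> real^'n^'m" where
  "stretch B s x = x + (s - 1) *\<^sub>R (\<chi> r c. if r = i \<and> c \<in> B then residual x c else 0)"

lemma system_mult_weights: "det (system x) \<noteq> 0 \<Longrightarrow> system x *v weights x = target x"
  by (simp add: cramer weights_def)

lemma weights_outside:
  assumes "det (system x) \<noteq> 0" "k \<notin> L"
  shows "weights x $ k = 0"
proof -
  have "target x $ k = (\<Sum>c\<in>UNIV. (if k = c then 1 else 0) * weights x $ c)"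
    using assms system_mult_weights[symmetric]
    by (simp add: system_def matrix_vector_mult_def)
  then show ?thesis
    using assms(2) by (simp add: target_def if_distrib[of "\<lambda>z. z * _"] cong: if_cong)
qed

lemma residual_at_nodes:
  assumes "det (system x) \<noteq> 0" "c \<in> \<sigma> ` L"
  shows "residual x c = 0"
proof -
  obtain l where l: "l \<in> L" "c = \<sigma> l"
    using assms(2) by blast
  have "x $ i $ \<sigma> l = (\<Sum>k\<in>UNIV. system x $ l $ k * weights x $ k)"
    using system_mult_weights[OF assms(1)] l(1)
    by (simp add: target_def matrix_vector_mult_def vec_eq_iff)
  also have "\<dots> = (\<Sum>k\<in>UNIV. weights x $ k * x $ k $ \<sigma> l)"
    using l(1) weights_outside[OF assms(1)] by (intro sum.cong) (auto simp: system_def)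
  finally show ?thesis
    by (simp add: residual_def l(2))
qed

lemma stretch_entry:
  "stretch B s x $ r $ c = x $ r $ c + (if r = i \<and> c \<in> B then (s - 1) * residual x c else 0)"
  by (simp add: stretch_def)

text \<open>
  The system and its solution depend only on the columns at the nodes. This is why stretching the
  other columns, although nonlinear, has the composition law of multiplication by shears.
\<close>
lemma stretch_system:
  assumes "\<sigma> ` L \<inter> B = {}"
  shows "system (stretch B s x) = system x" "weights (stretch B s x) = weights x"
proof -
  have nodes: "stretch B s x $ k $ \<sigma> l = x $ k $ \<sigma> l" if "l \<in> L" for k l
    using assms that by (auto simp: stretch_entry)
  show "system (stretch B s x) = system x"
    using nodes by (simp add: system_def vec_eq_iff)
  moreover have "target (stretch B s x) = target x"
    using nodes by (simp add: target_def vec_eq_iff)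
  ultimately show "weights (stretch B s x) = weights x"
    by (simp only: weights_def)
qed

lemma residual_stretch:
  assumes "\<sigma> ` L \<inter> B = {}" "det (system x) \<noteq> 0"
  shows "residual (stretch B s x) c = (if c \<in> B then s else 1) * residual x c"
proof -
  have "(\<Sum>k\<in>UNIV. weights x $ k * stretch B s x $ k $ c) = (\<Sum>k\<in>UNIV. weights x $ k * x $ k $ c)"
    using weights_outside[OF assms(2) i_notin_L] by (intro sum.cong) (auto simp: stretch_entry)
  then show ?thesis
    unfolding residual_def stretch_system[OF assms(1)]
    by (simp add: stretch_entry) (simp add: residual_def algebra_simps)
qed

lemma stretch_1 [simp]: "stretch B 1 x = x"
  by (simp add: stretch_def)

lemma stretch_stretch:
  assumes "\<sigma> ` L \<inter> B = {}" "det (system x) \<noteq> 0"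
  shows "stretch B t (stretch B s x) = stretch B (t * s) x"
  unfolding vec_eq_iff stretch_entry residual_stretch[OF assms] by (auto simp: algebra_simps)

text \<open>
  The shear undoes the contraction of the columns in \<open>A\<close>, stretches those in \<open>B\<close>, and fixes those
  at the nodes, where the residual is zero.
\<close>
lemma shear_stretch:
  assumes AB: "A \<inter> B = {}" "A \<union> B = - \<sigma> ` L" and det: "det (system x) \<noteq> 0" and s: "s \<noteq> 0"
  shows "shear i (weights x) s ** stretch A (1 / s) x = stretch B s x"
proof -
  have A: "\<sigma> ` L \<inter> A = {}"
    using AB by blast
  have res: "stretch A (1 / s) x $ i $ c - (\<Sum>k\<in>UNIV. weights x $ k * stretch A (1 / s) x $ k $ c) =
      (if c \<in> A then 1 / s else 1) * residual x c" for c
    using residual_stretch[OF A det] by (simp add: residual_def stretch_system[OF A])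
  have "c \<in> A \<and> c \<notin> B \<or> c \<notin> A \<and> c \<in> B \<or> c \<notin> A \<and> c \<notin> B \<and> residual x c = 0" for c
    using AB residual_at_nodes[OF det, of c] by blast
  then show ?thesis
    unfolding vec_eq_iff shear_mult_entry res unfolding stretch_entry
    using s by (auto simp: field_simps)
qed

lemma card_altered_stretch: "card {c. column c x \<noteq> column c (stretch B s x)} \<le> card B"
  by (intro card_mono) (auto simp: column_def vec_eq_iff stretch_entry)

lemma breakdown_point_le_if_stretches_in_domain:
  assumes T: "equivariant_estimator E (graph_group E) U T" and x: "x \<in> U"
    and L: "L \<subseteq> down_set E i" and det: "det (system x) \<noteq> 0"
    and AB: "A \<inter> B = {}" "A \<union> B = - \<sigma> ` L" "card A \<le> d" "card B \<le> d"
    and stretches: "\<And>C. \<exists>s>C. s > 0 \<and> stretch A (1 / s) x \<in> U \<and> stretch B s x \<in> U"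
  shows "breakdown_point U T x \<le> ereal (real d / real CARD('n))"
proof (rule breakdown_point_le_if_large_shears[OF T x])
  fix C
  obtain s where s: "s > C" "s > 0" "stretch A (1 / s) x \<in> U" "stretch B s x \<in> U"
    using stretches by blast
  let ?g = "shear i (weights x) s"
  have a: "weights x $ i = 0"
    using weights_outside[OF det i_notin_L] .
  have "?g \<in> graph_group E"
    using L weights_outside[OF det] s(2) by (intro shear_in_graph_group a) auto
  moreover have "?g ** stretch A (1 / s) x = stretch B s x"
    using s(2) by (intro shear_stretch AB det) simp
  moreover have "stretch A (1 / s) x \<in> altered_samples U x d" "stretch B s x \<in> altered_samples U x d"
    using s(3,4) order_trans[OF card_altered_stretch AB(3)] order_trans[OF card_altered_stretch AB(4)]
    by (simp_all add: altered_samples_def)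
  moreover have "\<bar>det ?g\<bar> > C"
    using s det_shear[of "weights x" i, OF a] by simp
  ultimately show "\<exists>g\<in>graph_group E. \<exists>z\<in>altered_samples U x d.
      g ** z \<in> altered_samples U x d \<and> \<bar>det g\<bar> > C"
    by (intro bexI[of _ ?g] bexI[of _ "stretch A (1 / s) x"] conjI) simp_all
qed

lemma polynomial_system: "real_polynomial_function (\<lambda>x. system x $ l $ k)"
  by (cases "l \<in> L \<and> k \<in> L"; cases "l = k")
    (auto simp: system_def real_polynomial_function_entry real_polynomial_function.intros(2))

lemma polynomial_target: "real_polynomial_function (\<lambda>x. target x $ l)"
  by (cases "l \<in> L")
    (simp_all add: target_def real_polynomial_function_entry real_polynomial_function.intros(2))

lemma polynomial_det_system: "real_polynomial_function (\<lambda>x. det (system x))"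
proof (rule real_polynomial_function_det)
  show "real_polynomial_function (\<lambda>x. system x $ l $ k)" for l k
    by (rule polynomial_system)
qed

lemma det_system_nonzero_somewhere: "\<exists>x. det (system x) \<noteq> 0"
proof
  let ?x = "\<chi> k c. if k \<in> L \<and> c = \<sigma> k then 1 else 0"
  have "system ?x = mat 1"
    using inj_\<sigma> by (auto simp: system_def mat_def vec_eq_iff inj_on_def)
  then show "det (system ?x) \<noteq> 0"
    by simp
qed

lemma stretch_differentiable:
  "stretch B s differentiable_on {x. det (system x) \<noteq> 0}"
proof -
  let ?N = "{x. det (system x) \<noteq> 0}"
  note poly = differentiable_at_real_polynomial_function
  have "(\<lambda>x. weights x $ k) differentiable (at x within ?N)" if "x \<in> ?N" for k x
  proof -
    have "real_polynomial_function
        (\<lambda>x. det (\<chi> l c. if c = k then target x $ l else system x $ l $ c))"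
    proof (rule real_polynomial_function_det)
      show "real_polynomial_function
          (\<lambda>x. (\<chi> l c. if c = k then target x $ l else system x $ l $ c) $ l $ c)"
        for l c
        by (cases "c = k") (simp_all add: polynomial_target polynomial_system)
    qed
    then show ?thesis
      using that unfolding weights_def
      by (simp add: differentiable_divide poly polynomial_det_system)
  qed
  then have "(\<lambda>x. residual x c) differentiable (at x within ?N)" if "x \<in> ?N" for c x
    unfolding residual_def using that
    by (intro derivative_intros finite ballI poly[OF real_polynomial_function_entry]) auto
  then have "(\<lambda>x. stretch B s x $ r $ c) differentiable (at x within ?N)" if "x \<in> ?N" for r c x
    unfolding stretch_entry using that
    by (cases "r = i \<and> c \<in> B")
      (auto intro!: derivative_intros poly[OF real_polynomial_function_entry])
  then have "(\<lambda>x. stretch B s x \<bullet> b) differentiable (at x within ?N)"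
    if "x \<in> ?N" "b \<in> Basis" for b x
    using that by (auto simp: Basis_vec_def inner_axis)
  then show ?thesis
    unfolding differentiable_on_def by (subst differentiable_componentwise_within) blast
qed

text \<open>
  A stretch by \<open>s\<close> is undone by the stretch by \<open>1 / s\<close>, so this preimage is contained in a
  differentiable image of a null set.
\<close>
lemma negligible_stretch_vimage:
  assumes B: "\<sigma> ` L \<inter> B = {}" and s: "s \<noteq> 0" and N: "negligible N"
  shows "negligible {x. det (system x) \<noteq> 0 \<and> stretch B s x \<in> N}"
proof (rule negligible_subset)
  let ?M = "N \<inter> {x. det (system x) \<noteq> 0}"
  show "negligible (stretch B (1 / s) ` ?M)"
  proof (rule negligible_differentiable_image_negligible)
    show "negligible ?M"
      using N by (rule negligible_subset) blast
    show "stretch B (1 / s) differentiable_on ?M"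
      using stretch_differentiable by (rule differentiable_on_subset) blast
  qed simp
  show "{x. det (system x) \<noteq> 0 \<and> stretch B s x \<in> N} \<subseteq> stretch B (1 / s) ` ?M"
  proof
    fix x
    assume x: "x \<in> {x. det (system x) \<noteq> 0 \<and> stretch B s x \<in> N}"
    then have "stretch B (1 / s) (stretch B s x) = x"
      using s by (simp add: stretch_stretch[OF B])
    then show "x \<in> stretch B (1 / s) ` ?M"
      using x by (force simp: stretch_system[OF B] image_iff)
  qed
qed

text \<open>
  For fixed \<open>x\<close> the stretched sample is affine in \<open>s\<close> and equals \<open>x\<close> at \<open>s = 1\<close>, so \<open>p\<close> restricts to a
  nonzero polynomial in \<open>s\<close> and excludes only finitely many values.
\<close>
lemma stretches_in_domain_generic:
  assumes p: "real_polynomial_function p" "\<And>x. p x \<noteq> 0 \<Longrightarrow> x \<in> U" and x: "p x \<noteq> 0"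
  shows "\<exists>s>C. s > 0 \<and> stretch A (1 / s) x \<in> U \<and> stretch B s x \<in> U"
proof -
  have fin: "finite {s. p (stretch B s x) = 0}" for B
  proof -
    let ?D = "\<chi> r c. if r = i \<and> c \<in> B then residual x c else 0"
    have "finite {t. p (x + t *\<^sub>R ?D) = 0}"
      using x by (intro finite_zeros_on_line[OF p(1), of _ 0]) simp
    then have "finite ((\<lambda>s. s - 1) -` {t. p (x + t *\<^sub>R ?D) = 0})"
      by (intro finite_vimageI) (auto simp: inj_def)
    then show ?thesis
      by (simp add: stretch_def vimage_def)
  qed
  have "finite ((\<lambda>s. 1 / s) -` {s. p (stretch A s x) = 0})"
    by (intro finite_vimageI fin) (auto simp: inj_def)
  then have "finite ((\<lambda>s. 1 / s) -` {s. p (stretch A s x) = 0} \<union> {s. p (stretch B s x) = 0})"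
    using fin by blast
  moreover have "infinite {max C 0<..}"
    by (rule infinite_Ioi)
  ultimately obtain s where "s \<in> {max C 0<..}"
    "s \<notin> (\<lambda>s. 1 / s) -` {s. p (stretch A s x) = 0} \<union> {s. p (stretch B s x) = 0}"
    by (meson finite_subset subsetI)
  then show ?thesis
    using p(2) by (intro exI[of _ s]) auto
qed

text \<open>
  Unboundedly many \<open>s\<close> are enough, so \<open>s\<close> may be restricted to the countable set of positive
  natural numbers, each of which excludes only a null set of samples.
\<close>
lemma stretches_in_domain_AE:
  assumes AB: "\<sigma> ` L \<inter> A = {}" "\<sigma> ` L \<inter> B = {}" and U: "negligible (- U)"
  shows "AE x in lebesgue. x \<in> U \<and> det (system x) \<noteq> 0 \<and>
    (\<forall>C. \<exists>s>C. s > 0 \<and> stretch A (1 / s) x \<in> U \<and> stretch B s x \<in> U)"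
proof -
  have ae: "AE x in lebesgue. P x" if "negligible {x. \<not> P x}" for P :: "real^'n^'m \<Rightarrow> bool"
    using that by (auto simp: eventually_ae_filter_negligible)
  have "AE x in lebesgue. x \<in> U"
    using U by (intro ae) (simp add: Compl_eq)
  moreover have "AE x in lebesgue. det (system x) \<noteq> 0"
    using negligible_zeros_real_polynomial[OF polynomial_det_system] det_system_nonzero_somewhere
    by (intro ae) auto
  moreover have "AE x in lebesgue. \<forall>k. det (system x) \<noteq> 0 \<longrightarrow>
      stretch A (1 / real (Suc k)) x \<in> U \<and> stretch B (real (Suc k)) x \<in> U"
  proof (subst AE_all_countable, intro allI ae)
    fix k
    have "negligible ({x. det (system x) \<noteq> 0 \<and> stretch A (1 / real (Suc k)) x \<in> - U} \<union>
        {x. det (system x) \<noteq> 0 \<and> stretch B (real (Suc k)) x \<in> - U})"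
      by (intro negligible_Un negligible_stretch_vimage AB U) auto
    then show "negligible {x. \<not> (det (system x) \<noteq> 0 \<longrightarrow>
        stretch A (1 / real (Suc k)) x \<in> U \<and> stretch B (real (Suc k)) x \<in> U)}"
      by (rule negligible_subset) auto
  qed
  ultimately show ?thesis
  proof eventually_elim
    case (elim x)
    have "\<exists>s>C. s > 0 \<and> stretch A (1 / s) x \<in> U \<and> stretch B s x \<in> U" for C
    proof -
      obtain k where "C < real k"
        using reals_Archimedean2 by blast
      then show ?thesis
        using elim by (intro exI[of _ "real (Suc k)"]) auto
    qed
    with elim show ?case
      by blast
  qed
qed

end

section \<open>The bound on the breakdown point\<close>

theorem proposition3p5:
  fixes E :: "'m::finite set set"
    and U :: "(real^'n::finite^'m) set"
    and T :: "real^'n^'m \<Rightarrow> real^'m^'m"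
  assumes "graph_edges E"
    and "(MAX i. card (down_set E i)) \<le> CARD('n)"
    and "equivariant_estimator E (graph_group E) U T"
  defines "bound \<equiv>
      1 / real CARD('n) *
        real_of_int \<lceil>(real CARD('n) - real (MAX i. card (down_set E i)) + 1) / 2\<rceil>"
  shows "(generically (\<lambda>x. x \<in> U) \<longrightarrow>
            generically (\<lambda>x. x \<in> U \<and> breakdown_point U T x \<le> ereal bound)) \<and>
         (AE x in lebesgue. x \<in> U \<and> breakdown_point U T x \<le> ereal bound)"
proof -
  note T = assms(3)
  define q where "q = (MAX i. card (down_set E i))"
  have "q \<in> range (\<lambda>i. card (down_set E i))"
    unfolding q_def by (intro Max_in) auto
  then obtain i where i: "card (down_set E i) = q"
    by auto
  have "i \<in> down_set E i"
    by (auto simp: down_set_def vertex_le_def)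
  define L where "L = down_set E i - {i}"
  have q1: "q \<ge> 1"
    using \<open>i \<in> down_set E i\<close> card_gt_0_iff[of "down_set E i"] by (auto simp flip: i simp: Suc_le_eq)
  have card_L: "card L = q - 1"
    using \<open>i \<in> down_set E i\<close> i by (simp add: L_def)
  have qn: "q \<le> CARD('n)"
    using assms(2) by (simp add: q_def)
  obtain \<sigma> :: "'m \<Rightarrow> 'n" where \<sigma>: "inj_on \<sigma> L"
    using card_le_inj[of L "UNIV :: 'n set"] card_L qn by
      (metis (no_types) diff_le_self finite order_trans)
  interpret row_interpolation i L \<sigma>
    by unfold_locales (use \<sigma> in \<open>auto simp: L_def\<close>)
  have L: "L \<subseteq> down_set E i"
    by (auto simp: L_def)
  \<comment> \<open>\<open>L\<close> leaves out \<open>i\<close> itself, so the nodes use up \<open>q - 1\<close> columns and \<open>N\<close> columns are free.\<close>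
  define N where "N = CARD('n) - q + 1"
  define d where "d = (N + 1) div 2"
  have card_free: "card (- \<sigma> ` L) = N"
    using card_image[OF \<sigma>] card_L q1 qn by (simp add: Compl_eq_Diff_UNIV card_Diff_subset N_def)
  obtain A where A: "A \<subseteq> - \<sigma> ` L" "card A = d"
    using obtain_subset_with_card_n[of d "- \<sigma> ` L"] card_free by (auto simp: d_def N_def)
  define B where "B = - \<sigma> ` L - A"
  have "card B = N - d"
    using A card_free by (simp add: B_def card_Diff_subset)
  then have AB: "A \<inter> B = {}" "A \<union> B = - \<sigma> ` L" "card A \<le> d" "card B \<le> d"
    using A by (auto simp: B_def d_def)
  have disj: "\<sigma> ` L \<inter> A = {}" "\<sigma> ` L \<inter> B = {}"
    using AB by auto
  have "\<lceil>(real CARD('n) - real q + 1) / 2\<rceil> = int d"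
  proof -
    have "real CARD('n) - real q + 1 = real N"
      using qn by (simp add: N_def of_nat_diff)
    moreover have "\<lceil>real N / 2\<rceil> = int d"
    proof (rule ceiling_unique)
      have "2 * d \<le> N + 1" "N \<le> 2 * d"
        by (auto simp: d_def)
      then have "2 * real d \<le> real N + 1" "real N \<le> 2 * real d"
        by linarith+
      then show "real_of_int (int d) - 1 < real N / 2" "real N / 2 \<le> real_of_int (int d)"
        by simp_all
    qed
    ultimately show ?thesis
      by simp
  qed
  then have bound: "bound = real d / real CARD('n)"
    by (simp add: bound_def flip: q_def)
  have bp: "breakdown_point U T x \<le> ereal bound"
    if "x \<in> U" "det (system x) \<noteq> 0"
      "\<And>C. \<exists>s>C. s > 0 \<and> stretch A (1 / s) x \<in> U \<and> stretch B s x \<in> U" for x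
    unfolding bound using breakdown_point_le_if_stretches_in_domain[OF T that(1) L that(2) AB that(3)] .
  have "generically (\<lambda>x. x \<in> U \<and> breakdown_point U T x \<le> ereal bound)"
    if gen: "generically (\<lambda>x. x \<in> U)"
  proof -
    obtain p :: "real^'n^'m \<Rightarrow> real" where p: "real_polynomial_function p" "\<exists>x. p x \<noteq> 0"
        "\<forall>x. p x \<noteq> 0 \<longrightarrow> x \<in> U"
      using gen unfolding generically_def by blast
    let ?r = "\<lambda>x. p x * det (system x)"
    have "real_polynomial_function ?r"
      using p(1) polynomial_det_system by (rule real_polynomial_function.intros(4))
    \<comment> \<open>Two null sets do not cover the space, so the product of nonzero polynomials is nonzero.\<close>
    moreover have "\<exists>x. ?r x \<noteq> 0"
    proof (rule ccontr)
      assume "\<not> (\<exists>x. ?r x \<noteq> 0)"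
      then have "{x. p x = 0} \<union> {x. det (system x) = 0} = UNIV"
        by auto
      moreover have "negligible ({x. p x = 0} \<union> {x. det (system x) = 0})"
        using p(2) det_system_nonzero_somewhere
          negligible_zeros_real_polynomial[OF p(1)]
          negligible_zeros_real_polynomial[OF polynomial_det_system]
        by (intro negligible_Un) auto
      ultimately show False
        by (simp add: non_negligible_UNIV)
    qed
    moreover have "x \<in> U \<and> breakdown_point U T x \<le> ereal bound" if "?r x \<noteq> 0" for x
      using that p(3) by (intro conjI bp stretches_in_domain_generic[OF p(1)]) auto
    ultimately show ?thesis
      unfolding generically_def by blast
  qed
  moreover have "AE x in lebesgue. x \<in> U \<and> breakdown_point U T x \<le> ereal bound"
  proof -
    have "negligible (- U)"
      using T by (simp add: equivariant_estimator_def)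
    from stretches_in_domain_AE[OF disj this] show ?thesis
      by eventually_elim (auto intro: bp)
  qed
  ultimately show ?thesis
    by blast
qed

end
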